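(* Let $\mu:\mathbb R^n\to[0,+\infty[$ be a positively homogeneous convex function such that $\mu(x)=0$ if and only if $x=0$ (it is not required that $\mu(-x)=\mu(x)$). Let $$X_\mu=\{z\in\mathbb C^n\mid \mu(\operatorname{Im} z)<\pi/4\}$$ and let $u_\mu:X_\mu\to[0,\pi/4[$ be defined by $u_\mu(z)=\mu(\operatorname{Im} z)$. Then $u_\mu\in\mathcal U(\mathbb R^n,X_\mu)$ is maximal, and for every $x\in\mathbb R^n$ and $\xi\in\mathbb R^n=T_x\mathbb R^n$, $$E_{\mathbb R^n,X_\mu}(x,\xi)=E_{u_\mu,X_\mu}(x,\xi)=\mu(\xi).$$
   Context: For $z\in\mathbb C^n$ write $z=x+iy$ with $x=\operatorname{Re}z$, $y=\operatorname{Im}z\in\mathbb R^n$; $\mathbb R^n\subset\mathbb C^n$ is the set of points with $\operatorname{Im}z=0$. "Positively homogeneous" means $\mu(tx)=t\mu(x)$ for $t>0$. For a complex manifold $M$ of complex dimension $n$ with complex structure $J$ on $TM$, and a closed totally real analytic submanifold $V\subset M$ of real dimension $n$ (here $M=X_\mu$, $V=\mathbb R^n$, $J\xi=i\xi$), $\mathcal U(V,M)$ is the class of all plurisubharmonic functions $u:M\to[0,\pi/4[$ with $u=0$ on $V$. A function $u\in\mathcal U(V,M)$ is maximal if $v\le u$ on $M$ for every $v\in\mathcal U(V,M)$, $u>0$ on $M\setminus V$, and $\sup_Mu=\pi/4$. For $p\in M$, $\eta\in T_pM$, $\Gamma_M(p,\eta)$ is the set of $C^1$ maps $\gamma:\,]-\varepsilon,\varepsilon[\,\to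 M$ (for some $\varepsilon>0$) with $\gamma(0)=p$, $\gamma'(0)=\eta$. For $p\in V$, $\xi\in T_pV$, $u\in\mathcal U(V,M)$, $$E_{u,M}(p,\xi)=\inf_{\gamma\in\Gamma_M(p,J\xi)}\limsup_{t\to0^+}\frac{u(\gamma(t))}{t},\qquad E_{V,M}(p,\xi)=\sup_{u\in\mathcal U(V,M)}E_{u,M}(p,\xi).$$ *)

theory Defs
  imports "HOL-Analysis.Analysis"
begin

section \<open>Real and imaginary coordinates on complex n-space\<close>

definition Im_vec :: "complex ^ 'n \<Rightarrow> real ^ 'n" where
  "Im_vec z = (\<chi> i. Im (z $ i))"

definition cvec :: "real ^ 'n \<Rightarrow> complex ^ 'n" where
  "cvec x = (\<chi> i. complex_of_real (x $ i))"

definition real_points :: "(complex ^ 'n) set" where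
  "real_points = {z. Im_vec z = 0}"

section \<open>Plurisubharmonic functions\<close>

text \<open>
  All functions below are real-valued; a function on a set is represented by a total function
  of which only the values on that set matter.
\<close>

definition usc_on :: "'a::topological_space set \<Rightarrow> ('a \<Rightarrow> real) \<Rightarrow> bool" where
  "usc_on S f \<longleftrightarrow> (\<forall>c. openin (top_of_set S) {x \<in> S. f x < c})"

text \<open>
  Upper semicontinuity and the sub-mean value inequality on all closed discs in the domain.
  The mean of an upper semicontinuous function over a circle always exists in
  \<open>[-\<infinity>, \<infinity>)\<close>, and for real-valued functions the sub-mean value inequality excludes
  \<open>-\<infinity>\<close>.  It therefore includes integrability over the circle, which must be
  required explicitly because Lebesgue integrals of non-integrable functions default to 0.
\<close>

definition subharmonic_on :: "complex set \<Rightarrow> (complex \<Rightarrow> real) \<Rightarrow> bool" where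
  "subharmonic_on S f \<longleftrightarrow> open S \<and> usc_on S f \<and>
     (\<forall>a r. 0 < r \<longrightarrow> cball a r \<subseteq> S \<longrightarrow>
        set_integrable lborel {0..2*pi} (\<lambda>t. f (a + of_real r * cis t)) \<and>
        f a \<le> 1 / (2*pi) * set_lebesgue_integral lborel {0..2*pi} (\<lambda>t. f (a + of_real r * cis t)))"

definition plurisubharmonic_on :: "(complex ^ 'n) set \<Rightarrow> (complex ^ 'n \<Rightarrow> real) \<Rightarrow> bool" where
  "plurisubharmonic_on M u \<longleftrightarrow> open M \<and> usc_on M u \<and>
     (\<forall>a b. subharmonic_on {\<zeta>. a + \<zeta> *s b \<in> M} (\<lambda>\<zeta>. u (a + \<zeta> *s b)))"

section \<open>The class U(V,M) and the Finsler functions\<close>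

definition psh_class :: "(complex ^ 'n) set \<Rightarrow> (complex ^ 'n) set \<Rightarrow> (complex ^ 'n \<Rightarrow> real) set" where
  "psh_class V M = {u. plurisubharmonic_on M u \<and> (\<forall>z\<in>M. 0 \<le> u z \<and> u z < pi/4) \<and> (\<forall>z\<in>V. u z = 0)}"

definition maximal_in :: "(complex ^ 'n) set \<Rightarrow> (complex ^ 'n) set \<Rightarrow> (complex ^ 'n \<Rightarrow> real) \<Rightarrow> bool" where
  "maximal_in V M u \<longleftrightarrow> u \<in> psh_class V M \<and> (\<forall>v\<in>psh_class V M. \<forall>z\<in>M. v z \<le> u z) \<and>
     (\<forall>z\<in>M - V. 0 < u z) \<and> (SUP z\<in>M. u z) = pi/4"

text \<open>
  The tangent space of an open \<open>M\<close> at each of its points is the whole space; curves are total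
  functions of which only a restriction to some interval around 0 is constrained.
\<close>

definition curves :: "(complex ^ 'n) set \<Rightarrow> complex ^ 'n \<Rightarrow> complex ^ 'n \<Rightarrow> (real \<Rightarrow> complex ^ 'n) set" where
  "curves M p \<eta> = {\<gamma>. \<exists>\<epsilon>>0. \<gamma> ` {-\<epsilon><..<\<epsilon>} \<subseteq> M \<and> \<gamma> C1_differentiable_on {-\<epsilon><..<\<epsilon>} \<and>
      \<gamma> 0 = p \<and> (\<gamma> has_vector_derivative \<eta>) (at 0)}"

definition finsler_of :: "(complex ^ 'n) set \<Rightarrow> (complex ^ 'n \<Rightarrow> real) \<Rightarrow> complex ^ 'n \<Rightarrow> complex ^ 'n \<Rightarrow> ereal" where
  "finsler_of M u p \<xi> =
     (INF \<gamma>\<in>curves M p (\<i> *s \<xi>). Limsup (at_right 0) (\<lambda>t. ereal (u (\<gamma> t) / t)))"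

definition finsler :: "(complex ^ 'n) set \<Rightarrow> (complex ^ 'n) set \<Rightarrow> complex ^ 'n \<Rightarrow> complex ^ 'n \<Rightarrow> ereal" where
  "finsler V M p \<xi> = (SUP u\<in>psh_class V M. finsler_of M u p \<xi>)"

section \<open>The tube domain of a gauge\<close>

definition tube :: "(real ^ 'n \<Rightarrow> real) \<Rightarrow> (complex ^ 'n) set" where
  "tube \<mu> = {z. \<mu> (Im_vec z) < pi/4}"

definition tube_fun :: "(real ^ 'n \<Rightarrow> real) \<Rightarrow> complex ^ 'n \<Rightarrow> real" where
  "tube_fun \<mu> z = \<mu> (Im_vec z)"

end

theory Submission
  imports Defs
begin

text \<open>
  Since \<open>\<mu>\<close> is convex, so is its composition with \<open>Im\<close> on every complex line, and convexity
  gives the sub-mean value inequality by pairing antipodal points of the circle.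
  For maximality, restrict a competitor \<open>v\<close> to the complex line \<open>\<zeta> \<mapsto> x + \<zeta> y\<close> through \<open>x + i y\<close>:
  it is a bounded subharmonic function on the strip \<open>0 \<le> Im \<zeta> < pi / (4 \<mu>(y))\<close> vanishing
  on the real line, so a Phragmen-Lindeloef argument bounds it by the linear
  function \<open>\<mu>(y) Im \<zeta>\<close>.  Finally \<open>\<mu>(Im \<gamma>(t)) / t = \<mu>(Im \<gamma>(t) / t)\<close> converges to \<open>\<mu>(\<xi>)\<close> along every
  admissible curve, which computes the Finsler functions.
\<close>

section \<open>Upper semicontinuous functions\<close>

lemma usc_on_continuous:
  assumes "continuous_on S f"
  shows "usc_on S f"
proof -
  have "openin (top_of_set S) (S \<inter> f -` {..<c})" for c
    using assms by (intro continuous_openin_preimage_gen) auto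
  moreover have "S \<inter> f -` {..<c} = {x \<in> S. f x < c}" for c
    by auto
  ultimately show ?thesis
    by (simp add: usc_on_def)
qed

lemma usc_on_subset:
  assumes "usc_on S f" "T \<subseteq> S"
  shows "usc_on T f"
  unfolding usc_on_def
proof
  fix c
  have "openin (top_of_set S) (S \<inter> {x. f x < c})"
    using assms(1) by (simp add: usc_on_def Int_def)
  then have "openin (top_of_set T) (T \<inter> {x. f x < c})"
    using assms(2) by (rule openin_subtopology_Int_subset)
  moreover have "T \<inter> {x. f x < c} = {x \<in> T. f x < c}"
    by auto
  ultimately show "openin (top_of_set T) {x \<in> T. f x < c}"
    by simp
qed

lemma usc_on_diff_continuous:
  assumes f: "usc_on S f" and q: "continuous_on S q"
  shows "usc_on S (\<lambda>x. f x - q x)"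
  unfolding usc_on_def
proof
  fix c
  \<comment> \<open>A real \<open>d\<close> strictly between \<open>f x\<close> and
    \<open>c + q x\<close> decouples the two functions: semicontinuity of \<open>f\<close> handles
    \<open>f x < d\<close>, continuity of \<open>q\<close> handles
    \<open>q x > d - c\<close>.\<close>
  have "{x \<in> S. f x - q x < c} = (\<Union>d. {x \<in> S. f x < d} \<inter> (S \<inter> q -` {d - c<..}))"
  proof (intro equalityI subsetI)
    fix x assume "x \<in> {x \<in> S. f x - q x < c}"
    then have "x \<in> S" "f x < c + q x" by auto
    then obtain d where "f x < d" "d < c + q x"
      using dense by blast
    then show "x \<in> (\<Union>d. {x \<in> S. f x < d} \<inter> (S \<inter> q -` {d - c<..}))"
      using \<open>x \<in> S\<close> by auto
  qed auto
  moreover have "openin (top_of_set S) (\<Union>d. {x \<in> S. f x < d} \<inter> (S \<inter> q -` {d - c<..}))"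
    using f q unfolding usc_on_def
    by (intro openin_clauses(3) ballI) (auto intro!: openin_Int continuous_openin_preimage_gen)
  ultimately show "openin (top_of_set S) {x \<in> S. f x - q x < c}"
    by simp
qed

text \<open>Without a maximum the sets \<open>U y\<close> would form a relatively open cover of
  \<open>K\<close>. In a finite subcover, the index with the largest value of \<open>f\<close> would
  lie in some \<open>U z\<close>, making \<open>f z\<close> larger still.\<close>

lemma usc_on_compact_attains_max:
  assumes f: "usc_on K f" and K: "compact K" "K \<noteq> {}"
  obtains p where "p \<in> K" "\<And>x. x \<in> K \<Longrightarrow> f x \<le> f p"
proof (rule ccontr)
  assume "\<not> thesis"
  with that have *: "\<exists>y\<in>K. f x < f y" if "x \<in> K" for x
    using \<open>x \<in> K\<close> by (meson not_le)
  define U where "U y = {x \<in> K. f x < f y}" for y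
  have "\<forall>y\<in>K. openin (top_of_set K) (U y)"
    using f by (simp add: U_def usc_on_def)
  moreover have "K \<subseteq> (\<Union>y\<in>K. U y)"
    using * by (auto simp: U_def)
  moreover have "\<forall>\<U>. Ball \<U> (openin (top_of_set K)) \<and> K \<subseteq> \<Union>\<U> \<longrightarrow>
      (\<exists>\<U>'\<subseteq>\<U>. finite \<U>' \<and> K \<subseteq> \<Union>\<U>')"
    using K(1) compact_eq_openin_cover by blast
  ultimately have "\<exists>\<U>'\<subseteq>U ` K. finite \<U>' \<and> K \<subseteq> \<Union>\<U>'"
    by (metis (mono_tags, lifting) image_iff)
  then obtain Y where Y: "Y \<subseteq> K" "finite Y" "K \<subseteq> \<Union>(U ` Y)"
    by (metis finite_subset_image)
  with K(2) have "Y \<noteq> {}" by auto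
  then have "Max (f ` Y) \<in> f ` Y"
    using Y(2) by (intro Max_in) auto
  then obtain y where "y \<in> Y" "Max (f ` Y) = f y"
    by blast
  then have "f z \<le> f y" if "z \<in> Y" for z
    using Y(2) that by (metis Max_ge finite_imageI imageI)
  moreover obtain z where "z \<in> Y" "f y < f z"
    using Y \<open>y \<in> Y\<close> by (auto simp: U_def)
  ultimately show False by force
qed

section \<open>Circle means\<close>

text \<open>Convexity is asked on the whole plane: this yields continuity, hence semicontinuity and
  integrability, and lets the open set be arbitrary. The centre is the midpoint of antipodal points
  of the circle.\<close>

lemma subharmonic_on_convex:
  fixes g :: "complex \<Rightarrow> real"
  assumes convex: "convex_on UNIV g" and S: "open S"
  shows "subharmonic_on S g"
  unfolding subharmonic_on_def
proof (intro conjI allI impI)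
  have cont: "continuous_on UNIV g"
    using convex by (simp add: convex_on_continuous)
  show "open S" by fact
  show "usc_on S g"
    using cont continuous_on_subset usc_on_continuous by blast
  fix a :: complex and r :: real
  define h where "h t = g (a + of_real r * cis t)" for t
  have h: "continuous_on T h" for T
    unfolding h_def by (intro continuous_on_compose2[OF cont] continuous_intros) auto
  show int: "set_integrable lborel {0..2*pi} (\<lambda>t. g (a + of_real r * cis t))"
    using borel_integrable_atLeastAtMost'[OF h, of 0 "2*pi"] by (simp add: h_def[abs_def])
  have antipodal: "2 * g a \<le> h t + h (t + pi)" for t
  proof -
    have "a = (1/2) *\<^sub>R (a + of_real r * cis t) + (1/2) *\<^sub>R (a + of_real r * cis (t + pi))"
      by (simp add: complex_eq_iff cos_add sin_add field_simps)
    then have "g a \<le> (1/2) * h t + (1/2) * h (t + pi)"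
      using convex_onD[OF convex, of "1/2" "a + of_real r * cis t" "a + of_real r * cis (t + pi)"]
      by (simp add: h_def)
    then show ?thesis by simp
  qed
  have io: "h integrable_on {u..v}" for u v
    using h by (rule integrable_continuous_real)
  have "(h has_integral integral {pi..2*pi} h) {pi..2*pi}"
    using io by blast
  then have shift: "((\<lambda>t. h (t + pi)) has_integral integral {pi..2*pi} h) {0..pi}"
    using has_integral_shift_real_ivl[of h _ pi "2 * pi" pi] by simp
  \<comment> \<open>The antipodal inequality is integrated over half of the circle; the shifted
    summand supplies the other half.\<close>
  have "2 * g a * pi = integral {0..pi} (\<lambda>t. 2 * g a)"
    by simp
  also have "\<dots> \<le> integral {0..pi} (\<lambda>t. h t + h (t + pi))"
    using antipodal shift io by (intro integral_le integrable_add) auto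
  also have "\<dots> = integral {0..pi} h + integral {pi..2*pi} h"
    using shift io by (subst integral_add) (auto simp: integral_unique)
  also have "\<dots> = integral {0..2*pi} h"
    using io by (intro Henstock_Kurzweil_Integration.integral_combine) auto
  also have "\<dots> = set_lebesgue_integral lborel {0..2*pi} h"
    using set_borel_integral_eq_integral(2)[OF int] by (simp add: h_def[abs_def])
  finally show "g a \<le> 1 / (2*pi) * set_lebesgue_integral lborel {0..2*pi} (\<lambda>t. g (a + of_real r * cis t))"
    unfolding h_def[abs_def, symmetric] by (simp add: field_simps)
qed

section \<open>Comparison with quadratics and the maximum principle on a strip\<close>

text \<open>The Laplacian of \<open>q\<close> is the constant
  \<open>2 * (\<beta> + \<gamma>)\<close>, so the circle mean exceeds the central value by
  \<open>r\<^sup>2 / 4\<close> times this constant.\<close>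

lemma circle_integral_quadratic:
  fixes a :: complex and q :: "complex \<Rightarrow> real"
  assumes "\<And>\<zeta>. q \<zeta> = \<alpha> * Im \<zeta> + \<beta> * (Re \<zeta>)\<^sup>2 + \<gamma> * (Im \<zeta>)\<^sup>2 + \<delta>"
  shows "((\<lambda>t. q (a + of_real r * cis t)) has_integral 2 * pi * (q a + (\<beta> + \<gamma>) * r\<^sup>2 / 2)) {0..2*pi}"
proof -
  \<comment> \<open>An explicit antiderivative; \<open>t/2 + sin t * cos t / 2\<close> and
    \<open>t/2 - sin t * cos t / 2\<close> are primitives of the squares of cosine and sine.\<close>
  define F where "F t = \<alpha> * (Im a * t - r * cos t)
    + \<beta> * ((Re a)\<^sup>2 * t + 2 * Re a * r * sin t + r\<^sup>2 * (t/2 + sin t * cos t / 2))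
    + \<gamma> * ((Im a)\<^sup>2 * t - 2 * Im a * r * cos t + r\<^sup>2 * (t/2 - sin t * cos t / 2)) + \<delta> * t" for t
  have "(F has_real_derivative q (a + of_real r * cis t)) (at t within {0..2*pi})" for t
  proof -
    have "(F has_real_derivative
        \<alpha> * (Im a + r * sin t)
        + \<beta> * ((Re a)\<^sup>2 + 2 * Re a * r * cos t + r\<^sup>2 * (1/2 + (cos t * cos t - sin t * sin t) / 2))
        + \<gamma> * ((Im a)\<^sup>2 + 2 * Im a * r * sin t + r\<^sup>2 * (1/2 - (cos t * cos t - sin t * sin t) / 2)) + \<delta>)
        (at t within {0..2*pi})"
      unfolding F_def by (auto intro!: derivative_eq_intros simp: field_simps)
    moreover have "1/2 + (cos t * cos t - sin t * sin t) / 2 = (cos t)\<^sup>2"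
      "1/2 - (cos t * cos t - sin t * sin t) / 2 = (sin t)\<^sup>2"
      using sin_cos_squared_add[of t] by (simp_all add: power2_eq_square field_simps)
    moreover have "q (a + of_real r * cis t)
        = \<alpha> * (Im a + r * sin t) + \<beta> * ((Re a)\<^sup>2 + 2 * Re a * r * cos t + r\<^sup>2 * (cos t)\<^sup>2)
          + \<gamma> * ((Im a)\<^sup>2 + 2 * Im a * r * sin t + r\<^sup>2 * (sin t)\<^sup>2) + \<delta>"
      by (simp add: assms power2_sum power_mult_distrib algebra_simps)
    ultimately show ?thesis
      by (simp only:)
  qed
  then have "((\<lambda>t. q (a + of_real r * cis t)) has_integral (F (2*pi) - F 0)) {0..2*pi}"
    by (intro fundamental_theorem_of_calculus) (auto simp: has_real_derivative_iff_has_vector_derivative)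
  moreover have "F (2*pi) - F 0 = 2 * pi * (q a + (\<beta> + \<gamma>) * r\<^sup>2 / 2)"
    by (simp add: F_def assms algebra_simps)
  ultimately show ?thesis by simp
qed

text \<open>At a maximum of \<open>f - q\<close> over \<open>U\<close>, a vertical translate of
  \<open>q\<close> would touch \<open>f\<close> from above. The mean of \<open>f\<close> over a
  small circle would then be at most that of the translate, which is strictly below
  \<open>f p\<close> because \<open>q\<close> has negative Laplacian.\<close>

lemma subharmonic_on_no_interior_max:
  fixes q :: "complex \<Rightarrow> real"
  assumes f: "subharmonic_on S f"
    and q: "\<And>\<zeta>. q \<zeta> = \<alpha> * Im \<zeta> + \<beta> * (Re \<zeta>)\<^sup>2 + \<gamma> * (Im \<zeta>)\<^sup>2 + \<delta>"
    and superharmonic: "\<beta> + \<gamma> < 0"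
    and U: "open U" "U \<subseteq> S" "p \<in> U"
  obtains \<zeta> where "\<zeta> \<in> U" "f p - q p < f \<zeta> - q \<zeta>"
proof (rule ccontr)
  assume "\<not> thesis"
  with that have max: "f \<zeta> \<le> q \<zeta> + (f p - q p)" if "\<zeta> \<in> U" for \<zeta>
    using \<open>\<zeta> \<in> U\<close> by (smt (verit))
  obtain r where r: "0 < r" "cball p r \<subseteq> U"
    using U open_contains_cball by blast
  define h where "h t = f (p + of_real r * cis t)" for t
  have fi: "set_integrable lborel {0..2*pi} h"
    and fp: "f p \<le> 1 / (2*pi) * set_lebesgue_integral lborel {0..2*pi} h"
    using f r U(2) unfolding subharmonic_on_def h_def by (meson order_trans)+
  \<comment> \<open>The translate of \<open>q\<close> that agrees with \<open>f\<close> at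
    \<open>p\<close>.\<close>
  define Q where "Q \<zeta> = q \<zeta> + (f p - q p)" for \<zeta>
  have "Q \<zeta> = \<alpha> * Im \<zeta> + \<beta> * (Re \<zeta>)\<^sup>2 + \<gamma> * (Im \<zeta>)\<^sup>2 + (\<delta> + (f p - q p))" for \<zeta>
    by (simp add: Q_def q)
  from circle_integral_quadratic[of Q, OF this, of p r]
  have Qi: "((\<lambda>t. Q (p + of_real r * cis t)) has_integral 2 * pi * (f p + (\<beta> + \<gamma>) * r\<^sup>2 / 2)) {0..2*pi}"
    by (simp add: Q_def)
  have "p + of_real r * cis t \<in> U" for t
    using r by (auto simp: dist_norm norm_mult intro!: subsetD[OF r(2)])
  then have "integral {0..2*pi} h \<le> integral {0..2*pi} (\<lambda>t. Q (p + of_real r * cis t))"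
    using max Qi set_borel_integral_eq_integral(1)[OF fi]
    by (intro integral_le) (auto simp: h_def Q_def)
  then have "2 * pi * f p \<le> 2 * pi * (f p + (\<beta> + \<gamma>) * r\<^sup>2 / 2)"
    using fp set_borel_integral_eq_integral(2)[OF fi] integral_unique[OF Qi] by (simp add: field_simps)
  then have "0 \<le> (\<beta> + \<gamma>) * r\<^sup>2"
    by simp
  then show False
    using superharmonic r(1) by (simp add: zero_le_mult_iff)
qed

text \<open>Phragmen-Lindeloef: boundedness of \<open>f\<close> compensates for the missing control
  at infinity. The linear majorant is perturbed by a small quadratic so that only a compact
  rectangle matters, and the perturbation at \<open>z\<close> costs at most
  \<open>e\<close>.\<close>

lemma subharmonic_on_strip_le:
  assumes f: "subharmonic_on S f" and T: "0 < T" and B: "0 \<le> B"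
    and S: "{\<zeta>. 0 \<le> Im \<zeta> \<and> Im \<zeta> \<le> T} \<subseteq> S"
    and bound: "\<And>\<zeta>. 0 \<le> Im \<zeta> \<Longrightarrow> Im \<zeta> \<le> T \<Longrightarrow> f \<zeta> \<le> B"
    and real: "\<And>\<zeta>. Im \<zeta> = 0 \<Longrightarrow> f \<zeta> \<le> 0"
    and z: "0 \<le> Im z" "Im z \<le> T"
  shows "f z \<le> B * Im z / T"
proof (rule field_le_epsilon)
  fix e :: real assume "0 < e"
  \<comment> \<open>Scaled so that the bound
    \<open>\<epsilon> * ((Re z)\<^sup>2 + 2 * T\<^sup>2)\<close> on the perturbation at
    \<open>z\<close> equals \<open>e\<close>.\<close>
  define \<epsilon> where "\<epsilon> = e / ((Re z)\<^sup>2 + 2 * T\<^sup>2)"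
  have den: "0 < (Re z)\<^sup>2 + 2 * T\<^sup>2"
    using T by (simp add: add_nonneg_pos)
  then have \<epsilon>: "0 < \<epsilon>"
    using \<open>0 < e\<close> by (simp add: \<epsilon>_def)
  \<comment> \<open>The strictly superharmonic term, nonnegative on the strip and growing along it, takes the
    maximum to the boundary of a large rectangle.\<close>
  define q where "q \<zeta> = B / T * Im \<zeta> + \<epsilon> * (Re \<zeta>)\<^sup>2 + (- 2 * \<epsilon>) * (Im \<zeta>)\<^sup>2 + 2 * \<epsilon> * T\<^sup>2" for \<zeta>
  \<comment> \<open>The first summand places \<open>z\<close> in the rectangle, the second makes
    \<open>\<epsilon> * R\<^sup>2\<close> reach \<open>B\<close> on the vertical sides.\<close>
  define R where "R = \<bar>Re z\<bar> + sqrt (B / \<epsilon>)"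
  have R: "\<bar>Re z\<bar> \<le> R" "B \<le> \<epsilon> * R\<^sup>2"
  proof -
    show "\<bar>Re z\<bar> \<le> R" using B \<epsilon> by (simp add: R_def)
    have "(sqrt (B / \<epsilon>))\<^sup>2 \<le> R\<^sup>2"
      unfolding R_def using B \<epsilon> by (intro power_mono) auto
    then show "B \<le> \<epsilon> * R\<^sup>2"
      using B \<epsilon> by (simp add: field_simps)
  qed
  define K where "K = cbox (Complex (- R) 0) (Complex R T)"
  define U where "U = box (Complex (- R) 0) (Complex R T)"
  have K: "\<zeta> \<in> K \<longleftrightarrow> - R \<le> Re \<zeta> \<and> Re \<zeta> \<le> R \<and> 0 \<le> Im \<zeta> \<and> Im \<zeta> \<le> T" for \<zeta>
    by (auto simp: K_def in_cbox_complex_iff)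
  have U: "\<zeta> \<in> U \<longleftrightarrow> - R < Re \<zeta> \<and> Re \<zeta> < R \<and> 0 < Im \<zeta> \<and> Im \<zeta> < T" for \<zeta>
    by (auto simp: U_def in_box_complex_iff)
  have "z \<in> K"
    using R z by (auto simp: K)
  have "K \<subseteq> S"
    using S by (auto simp: K)
  then have "usc_on K f"
    using f usc_on_subset unfolding subharmonic_on_def by blast
  then have "usc_on K (\<lambda>\<zeta>. f \<zeta> - q \<zeta>)"
    unfolding q_def by (intro usc_on_diff_continuous continuous_intros)
  moreover have "compact K" by (simp add: K_def)
  moreover have "K \<noteq> {}" using \<open>z \<in> K\<close> by auto
  ultimately obtain p where p: "p \<in> K" "\<And>\<zeta>. \<zeta> \<in> K \<Longrightarrow> f \<zeta> - q \<zeta> \<le> f p - q p"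
    by (rule usc_on_compact_attains_max) blast
  have "p \<notin> U"
  proof
    assume "p \<in> U"
    have "U \<subseteq> K"
      by (auto simp: K U)
    \<comment> \<open>The quadratic coefficients of \<open>q\<close> sum to
      \<open>- \<epsilon>\<close>, which gives the strict superharmonicity.\<close>
    have "open U" "U \<subseteq> S" "\<epsilon> + - 2 * \<epsilon> < 0"
      using \<open>K \<subseteq> S\<close> \<open>U \<subseteq> K\<close> \<epsilon> by (auto simp: U_def)
    then obtain \<zeta> where "\<zeta> \<in> U" "f p - q p < f \<zeta> - q \<zeta>"
      using \<open>p \<in> U\<close> by (elim subharmonic_on_no_interior_max[OF f q_def, rotated 1])
    then show False
      using p(2) \<open>U \<subseteq> K\<close> by force
  qed
  then consider "Im p = 0" | "Im p = T" | "\<bar>Re p\<bar> = R"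
    using p(1) by (force simp: K U)
  \<comment> \<open>On the bottom side \<open>f\<close> is at most 0; on the top side the linear
    term equals \<open>B\<close>; on the vertical sides \<open>\<epsilon> * R\<^sup>2\<close>
    exceeds or equals \<open>B\<close>. The constant \<open>2 * \<epsilon> * T\<^sup>2\<close>
    always absorbs the negative square.\<close>
  then have "f p \<le> q p"
  proof cases
    case 1
    then have "0 \<le> q p"
      using \<epsilon> by (simp add: q_def)
    then show ?thesis
      using real[of p] 1 by simp
  next
    case 2
    then show ?thesis
      using bound[of p] \<epsilon> T by (simp add: q_def add_increasing2)
  next
    case 3
    then have "B \<le> \<epsilon> * (Re p)\<^sup>2"
      using R(2) by (metis power2_abs)
    moreover have "\<epsilon> * (Im p)\<^sup>2 \<le> \<epsilon> * T\<^sup>2" "0 \<le> B / T * Im p"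
      using p(1) \<epsilon> T B by (auto simp: K intro!: mult_left_mono power_mono)
    moreover have "f p \<le> B"
      using p(1) bound by (simp add: K)
    ultimately show ?thesis
      by (simp add: q_def)
  qed
  then have "f z \<le> q z"
    using p(2)[OF \<open>z \<in> K\<close>] by simp
  also have "q z \<le> B * Im z / T + \<epsilon> * ((Re z)\<^sup>2 + 2 * T\<^sup>2)"
    using \<epsilon> by (simp add: q_def algebra_simps)
  also have "\<epsilon> * ((Re z)\<^sup>2 + 2 * T\<^sup>2) = e"
    using den by (simp add: \<epsilon>_def)
  finally show "f z \<le> B * Im z / T + e" .
qed

section \<open>Tube domains\<close>

lemma Im_vec_add: "Im_vec (z + w) = Im_vec z + Im_vec w"
  by (simp add: Im_vec_def vec_eq_iff)

lemma Im_vec_scaleR: "Im_vec (c *\<^sub>R z) = c *\<^sub>R Im_vec z"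
  by (simp add: Im_vec_def vec_eq_iff)

lemma linear_Im_vec: "linear Im_vec"
  by (simp add: linear_iff Im_vec_add Im_vec_scaleR)

lemma Im_vec_cvec [simp]: "Im_vec (cvec x) = 0"
  by (simp add: Im_vec_def cvec_def vec_eq_iff)

lemma Im_vec_mult_cvec: "Im_vec (\<zeta> *s cvec x) = Im \<zeta> *\<^sub>R x"
  by (simp add: Im_vec_def cvec_def vec_eq_iff)

lemma linear_vector_smult_left: "linear (\<lambda>\<zeta>. \<zeta> *s (b :: complex ^ 'n))"
  by (simp add: linear_iff vec_eq_iff algebra_simps)

lemma decompose_Im_vec: obtains x where "z = cvec x + \<i> *s cvec (Im_vec z)"
proof
  show "z = cvec (\<chi> i. Re (z $ i)) + \<i> *s cvec (Im_vec z)"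
    by (simp add: vec_eq_iff cvec_def Im_vec_def complex_eq_iff)
qed

lemma convex_on_compose_affine:
  assumes "convex_on UNIV f" "linear L"
  shows "convex_on UNIV (\<lambda>x. f (c + L x))"
proof (rule convex_onI)
  fix t :: real and x y
  assume t: "0 < t" "t < 1"
  have "c + L ((1 - t) *\<^sub>R x + t *\<^sub>R y) = (1 - t) *\<^sub>R (c + L x) + t *\<^sub>R (c + L y)"
    by (simp add: linear_add[OF assms(2)] linear_diff[OF assms(2)] linear_scale[OF assms(2)] scaleR_add_right scaleR_diff_left)
  then show "f (c + L ((1 - t) *\<^sub>R x + t *\<^sub>R y)) \<le> (1 - t) * f (c + L x) + t * f (c + L y)"
    using convex_onD[OF assms(1), of t "c + L x" "c + L y"] t by simp
qed auto

section \<open>Difference quotients along admissible curves\<close>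

text \<open>The imaginary part of the curve starts at 0 with velocity \<open>\<xi>\<close>, and
  homogeneity moves the factor \<open>1 / t\<close> inside \<mu>. The limit does not depend on the
  curve, so the infimum over curves becomes trivial.\<close>

lemma Limsup_tube_fun_curve:
  fixes \<mu> :: "real ^ 'n \<Rightarrow> real"
  assumes homogeneous: "\<And>t x. 0 < t \<Longrightarrow> \<mu> (t *\<^sub>R x) = t * \<mu> x"
    and cont: "continuous_on UNIV \<mu>"
    and \<gamma>: "\<gamma> 0 = cvec x" "(\<gamma> has_vector_derivative \<i> *s cvec \<xi>) (at 0)"
  shows "Limsup (at_right 0) (\<lambda>t. ereal (tube_fun \<mu> (\<gamma> t) / t)) = ereal (\<mu> \<xi>)"
proof -
  have "((\<lambda>t. Im_vec (\<gamma> t)) has_vector_derivative Im_vec (\<i> *s cvec \<xi>)) (at 0)"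
    using bounded_linear.has_vector_derivative[OF _ \<gamma>(2)] linear_Im_vec linear_conv_bounded_linear
    by blast
  then have "((\<lambda>t. Im_vec (\<gamma> t)) has_vector_derivative \<xi>) (at_right 0)"
    by (auto simp: Im_vec_mult_cvec intro: has_vector_derivative_at_within)
  then have "((\<lambda>t. (Im_vec (\<gamma> t) - t *\<^sub>R \<xi>) /\<^sub>R \<bar>t\<bar>) \<longlongrightarrow> 0) (at_right 0)"
    by (simp add: has_vector_derivative_def has_derivative_at_within \<gamma>(1))
  \<comment> \<open>For positive \<open>t\<close> the absolute value in the derivative quotient
    disappears.\<close>
  moreover have "\<forall>\<^sub>F t in at_right (0::real).
      (Im_vec (\<gamma> t) - t *\<^sub>R \<xi>) /\<^sub>R \<bar>t\<bar> = (1 / t) *\<^sub>R Im_vec (\<gamma> t) - \<xi>"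
    by (rule eventually_at_rightI[of 0 1]) (auto simp: scaleR_diff_right inverse_eq_divide)
  ultimately have "((\<lambda>t. (1 / t) *\<^sub>R Im_vec (\<gamma> t) - \<xi>) \<longlongrightarrow> 0) (at_right 0)"
    using tendsto_cong by fast
  then have "((\<lambda>t. (1 / t) *\<^sub>R Im_vec (\<gamma> t)) \<longlongrightarrow> \<xi>) (at_right 0)"
    by (rule Lim_null[THEN iffD2])
  then have "((\<lambda>t. \<mu> ((1 / t) *\<^sub>R Im_vec (\<gamma> t))) \<longlongrightarrow> \<mu> \<xi>) (at_right 0)"
    by (rule continuous_on_tendsto_compose[OF cont]) auto
  moreover have "\<forall>\<^sub>F t in at_right (0::real). \<mu> ((1 / t) *\<^sub>R Im_vec (\<gamma> t)) = tube_fun \<mu> (\<gamma> t) / t"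
    by (rule eventually_at_rightI[of 0 1]) (auto simp: homogeneous tube_fun_def)
  ultimately have "((\<lambda>t. tube_fun \<mu> (\<gamma> t) / t) \<longlongrightarrow> \<mu> \<xi>) (at_right 0)"
    using tendsto_cong by fast
  then show ?thesis
    by (intro lim_imp_Limsup) auto
qed

text \<open>A curve need lie in \<open>M\<close> only near 0, which suffices because the limsup sees
  only small positive \<open>t\<close>. This reduces the supremum over the class to its largest
  member.\<close>

lemma finsler_of_mono:
  assumes "\<And>z. z \<in> M \<Longrightarrow> u z \<le> v z"
  shows "finsler_of M u p \<xi> \<le> finsler_of M v p \<xi>"
  unfolding finsler_of_def
proof (intro INF_mono bexI Limsup_mono)
  fix \<gamma> assume "\<gamma> \<in> curves M p (\<i> *s \<xi>)"
  then obtain \<epsilon> where \<epsilon>: "0 < \<epsilon>" "\<gamma> ` {-\<epsilon><..<\<epsilon>} \<subseteq> M"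
    by (auto simp: curves_def)
  show "\<forall>\<^sub>F t in at_right 0. ereal (u (\<gamma> t) / t) \<le> ereal (v (\<gamma> t) / t)"
  proof (rule eventually_at_rightI[of 0 \<epsilon>])
    fix t assume t: "t \<in> {0<..<\<epsilon>}"
    then have "\<gamma> t \<in> M"
      using \<epsilon> by (intro subsetD[OF \<epsilon>(2)]) auto
    then show "ereal (u (\<gamma> t) / t) \<le> ereal (v (\<gamma> t) / t)"
      using assms t by (simp add: divide_right_mono)
  qed fact
qed

text \<open>Guarantees a nonempty family of curves; over an empty one the infimum in
  \<open>ereal\<close> would be infinite.\<close>

lemma affine_curve_in_curves:
  assumes "open M" "p \<in> M"
  shows "(\<lambda>t. p + t *\<^sub>R \<eta>) \<in> curves M p \<eta>"
proof -
  have "open ((\<lambda>t. p + t *\<^sub>R \<eta>) -` M)"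
    using assms(1) by (intro open_vimage continuous_intros)
  then obtain \<epsilon> where "0 < \<epsilon>" "ball 0 \<epsilon> \<subseteq> (\<lambda>t. p + t *\<^sub>R \<eta>) -` M"
    using assms(2) by (metis (mono_tags, lifting) add.right_neutral open_contains_ball scale_zero_left vimageI)
  moreover have "(\<lambda>t. p + t *\<^sub>R \<eta>) C1_differentiable_on {-\<epsilon><..<\<epsilon>}"
    unfolding C1_differentiable_on_def
    by (rule exI[of _ "\<lambda>_. \<eta>"]) (auto intro!: derivative_eq_intros continuous_intros)
  moreover have "((\<lambda>t. p + t *\<^sub>R \<eta>) has_vector_derivative \<eta>) (at 0)"
    by (auto intro!: derivative_eq_intros)
  ultimately show ?thesis
    by (auto simp: curves_def ball_eq_greaterThanLessThan)
qed

section \<open>Maximality and Finsler functions for a fixed gauge\<close>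

context
  fixes \<mu> :: "real ^ 'n \<Rightarrow> real"
  assumes nonneg: "\<And>x. 0 \<le> \<mu> x"
    and homogeneous: "\<And>t x. 0 < t \<Longrightarrow> \<mu> (t *\<^sub>R x) = t * \<mu> x"
    and convex: "convex_on UNIV \<mu>"
    and definite: "\<And>x. \<mu> x = 0 \<longleftrightarrow> x = 0"
begin

lemma continuous_gauge: "continuous_on UNIV \<mu>"
  using convex by (simp add: convex_on_continuous)

lemma gauge_scaleR: "0 \<le> t \<Longrightarrow> \<mu> (t *\<^sub>R x) = t * \<mu> x"
  using homogeneous[of t x] definite[of 0] by (cases "t = 0") auto

lemma continuous_tube_fun: "continuous_on UNIV (tube_fun \<mu>)"
  unfolding tube_fun_def
  by (intro continuous_on_compose2[OF continuous_gauge] linear_continuous_on)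
    (use linear_Im_vec linear_conv_bounded_linear in auto)

lemma open_tube: "open (tube \<mu>)"
proof -
  have "tube \<mu> = tube_fun \<mu> -` {..<pi/4}"
    by (auto simp: tube_def tube_fun_def)
  then show ?thesis
    using continuous_tube_fun by (simp add: open_vimage)
qed

lemma real_points_subset_tube: "real_points \<subseteq> tube \<mu>"
  using definite[of 0] by (auto simp: real_points_def tube_def)

lemma tube_fun_psh_class: "tube_fun \<mu> \<in> psh_class real_points (tube \<mu>)"
proof -
  have "subharmonic_on {\<zeta>. a + \<zeta> *s b \<in> tube \<mu>} (\<lambda>\<zeta>. tube_fun \<mu> (a + \<zeta> *s b))" for a b
  proof (rule subharmonic_on_convex)
    have "linear (\<lambda>\<zeta>. Im_vec (\<zeta> *s b))"
      using linear_compose[OF linear_vector_smult_left linear_Im_vec] by (simp add: o_def)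
    from convex_on_compose_affine[OF convex this]
    show "convex_on UNIV (\<lambda>\<zeta>. tube_fun \<mu> (a + \<zeta> *s b))"
      by (simp add: tube_fun_def Im_vec_add)
    have "continuous_on UNIV (\<lambda>\<zeta>. a + \<zeta> *s b)"
      by (intro continuous_on_add continuous_on_const linear_continuous_on)
        (use linear_vector_smult_left linear_conv_bounded_linear in blast)
    then have "open ((\<lambda>\<zeta>. a + \<zeta> *s b) -` tube \<mu>)"
      using open_tube open_vimage by blast
    then show "open {\<zeta>. a + \<zeta> *s b \<in> tube \<mu>}"
      by (simp add: vimage_def)
  qed
  moreover have "usc_on (tube \<mu>) (tube_fun \<mu>)"
    using continuous_tube_fun continuous_on_subset usc_on_continuous by blast
  ultimately show ?thesis
    using open_tube nonneg definite
    by (auto simp: psh_class_def plurisubharmonic_on_def tube_fun_def tube_def real_points_def)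
qed

lemma psh_class_le_tube_fun:
  assumes v: "v \<in> psh_class real_points (tube \<mu>)" and z: "z \<in> tube \<mu>"
  shows "v z \<le> tube_fun \<mu> z"
proof (cases "Im_vec z = 0")
  case True
  then show ?thesis
    using v nonneg by (simp add: psh_class_def real_points_def tube_fun_def)
next
  case False
  define y where "y = Im_vec z"
  \<comment> \<open>The height at which the complex line leaves the tube, since
    \<open>\<mu> (T *\<^sub>R y) = pi / 4\<close>. The point \<open>z\<close> sits at the parameter
    \<open>\<i>\<close>, hence \<open>1 < T\<close>.\<close>
  define T where "T = pi / 4 / \<mu> y"
  have y: "0 < \<mu> y" "\<mu> y < pi / 4"
    using False nonneg[of y] definite[of y] z by (auto simp: y_def tube_def less_le)
  then have "1 < T"
    by (simp add: T_def)
  obtain x where x: "z = cvec x + \<i> *s cvec y"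
    using decompose_Im_vec y_def by blast
  have M: "cvec x + \<zeta> *s cvec y \<in> tube \<mu>" if "0 \<le> Im \<zeta>" "Im \<zeta> < T" for \<zeta>
    using that y by (simp add: tube_def Im_vec_add Im_vec_mult_cvec gauge_scaleR T_def field_simps)
  \<comment> \<open>The strip estimate needs a closed strip inside the domain, so the height stays
    strictly below \<open>T\<close>; the limit from the left then gives the sharp bound
    \<open>pi / 4 / T\<close>, which is \<open>\<mu> y\<close>.\<close>
  have "v z \<le> pi / 4 / T'" if T': "1 < T'" "T' < T" for T'
  proof -
    have "subharmonic_on {\<zeta>. cvec x + \<zeta> *s cvec y \<in> tube \<mu>} (\<lambda>\<zeta>. v (cvec x + \<zeta> *s cvec y))"
      using v by (simp add: psh_class_def plurisubharmonic_on_def)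
    then have "v (cvec x + \<i> *s cvec y) \<le> pi / 4 * Im \<i> / T'"
    proof (rule subharmonic_on_strip_le)
      show "{\<zeta>. 0 \<le> Im \<zeta> \<and> Im \<zeta> \<le> T'} \<subseteq> {\<zeta>. cvec x + \<zeta> *s cvec y \<in> tube \<mu>}"
        using M T' by auto
      show "v (cvec x + \<zeta> *s cvec y) \<le> pi / 4" if "0 \<le> Im \<zeta>" "Im \<zeta> \<le> T'" for \<zeta>
        using v M[of \<zeta>] that T' by (force simp: psh_class_def)
      show "v (cvec x + \<zeta> *s cvec y) \<le> 0" if "Im \<zeta> = 0" for \<zeta>
        using v that by (simp add: psh_class_def real_points_def Im_vec_add Im_vec_mult_cvec)
    qed (use T' in auto)
    then show ?thesis
      by (simp add: x)
  qed
  then have "\<forall>\<^sub>F T' in at_left T. v z \<le> pi / 4 / T'"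
    using \<open>1 < T\<close> by (intro eventually_at_leftI[of 1]) auto
  moreover have "((\<lambda>T'. pi / 4 / T') \<longlongrightarrow> pi / 4 / T) (at_left T)"
    using \<open>1 < T\<close> by (intro tendsto_intros) auto
  ultimately have "v z \<le> pi / 4 / T"
    by (intro tendsto_lowerbound) auto
  then show ?thesis
    using y by (simp add: T_def tube_fun_def y_def)
qed

lemma SUP_tube_fun: "(SUP z\<in>tube \<mu>. tube_fun \<mu> z) = pi/4"
proof (rule cSup_eq_non_empty)
  show "tube_fun \<mu> ` tube \<mu> \<noteq> {}"
    using real_points_subset_tube Im_vec_cvec[of 0] unfolding real_points_def by blast
  show "s \<le> pi / 4" if "s \<in> tube_fun \<mu> ` tube \<mu>" for s
    using that by (auto simp: tube_fun_def tube_def)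
  fix b assume b: "\<And>s. s \<in> tube_fun \<mu> ` tube \<mu> \<Longrightarrow> s \<le> b"
  \<comment> \<open>The all-ones vector serves as a nonzero direction; along the imaginary ray over
    it every value between 0 and \<open>pi / 4\<close> is attained.\<close>
  define e :: "real ^ 'n" where "e = 1"
  have e: "0 < \<mu> e"
    using nonneg[of e] definite[of e] by (simp add: e_def less_le vec_eq_iff)
  show "pi / 4 \<le> b"
  proof (rule dense_le_bounded[of 0])
    fix c :: real assume c: "0 < c" "c < pi / 4"
    define w where "w = \<i> *s cvec ((c / \<mu> e) *\<^sub>R e)"
    have w: "tube_fun \<mu> w = c"
      using c e by (simp add: w_def tube_fun_def Im_vec_mult_cvec gauge_scaleR)
    then have "w \<in> tube \<mu>"
      using c(2) by (simp add: tube_fun_def tube_def)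
    then show "c \<le> b"
      using b[OF imageI] w by metis
  qed simp
qed

lemma maximal_tube_fun: "maximal_in real_points (tube \<mu>) (tube_fun \<mu>)"
proof -
  have "0 < tube_fun \<mu> z" if "z \<notin> real_points" for z
    using that nonneg[of "Im_vec z"] definite[of "Im_vec z"]
    by (simp add: tube_fun_def real_points_def less_le)
  then show ?thesis
    using tube_fun_psh_class psh_class_le_tube_fun SUP_tube_fun by (simp add: maximal_in_def)
qed

lemma finsler_of_tube_fun: "finsler_of (tube \<mu>) (tube_fun \<mu>) (cvec x) (cvec \<xi>) = ereal (\<mu> \<xi>)"
proof -
  have "Limsup (at_right 0) (\<lambda>t. ereal (tube_fun \<mu> (\<gamma> t) / t)) = ereal (\<mu> \<xi>)"
    if "\<gamma> \<in> curves (tube \<mu>) (cvec x) (\<i> *s cvec \<xi>)" for \<gamma>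
    using that by (intro Limsup_tube_fun_curve[OF homogeneous continuous_gauge])
      (auto simp: curves_def)
  moreover have "curves (tube \<mu>) (cvec x) (\<i> *s cvec \<xi>) \<noteq> {}"
    using affine_curve_in_curves[OF open_tube] real_points_subset_tube
    by (force simp: real_points_def)
  ultimately show ?thesis
    by (simp add: finsler_of_def)
qed

lemma finsler_tube:
  "finsler real_points (tube \<mu>) p \<xi> = finsler_of (tube \<mu>) (tube_fun \<mu>) p \<xi>"
  unfolding finsler_def
  \<comment> \<open>The supremum is attained at \<open>tube_fun \<mu>\<close>, which belongs to the
    class and dominates it.\<close>
  by (intro antisym SUP_least SUP_upper tube_fun_psh_class finsler_of_mono psh_class_le_tube_fun)

end

theorem theorem6p1:
  fixes \<mu> :: "real ^ 'n \<Rightarrow> real"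
  assumes nonneg: "\<And>x. 0 \<le> \<mu> x"
    and homogeneous: "\<And>t x. 0 < t \<Longrightarrow> \<mu> (t *\<^sub>R x) = t * \<mu> x"
    and convex: "convex_on UNIV \<mu>"
    and definite: "\<And>x. \<mu> x = 0 \<longleftrightarrow> x = 0"
  shows "tube_fun \<mu> \<in> psh_class real_points (tube \<mu>)
    \<and> maximal_in real_points (tube \<mu>) (tube_fun \<mu>)
    \<and> (\<forall>x \<xi>. finsler real_points (tube \<mu>) (cvec x) (cvec \<xi>)
               = finsler_of (tube \<mu>) (tube_fun \<mu>) (cvec x) (cvec \<xi>)
             \<and> finsler_of (tube \<mu>) (tube_fun \<mu>) (cvec x) (cvec \<xi>) = ereal (\<mu> \<xi>))"
  using tube_fun_psh_class[OF assms] maximal_tube_fun[OF assms] finsler_tube[OF assms]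
    finsler_of_tube_fun[OF assms]
  by blast

end
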